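(* Let $A\in\mathbb{R}^{n\times n}$, $\mathbf{v},\mathbf{w}\in\mathbb{R}^n$, and $\hat A=A+\mathbf{v}\mathbf{w}^T$, and suppose that all leading principal minors of $A$ and of $\hat A$ are nonzero (in particular both matrices are nonsingular). Let $LD^{-1}U$ and $\hat L\hat D^{-1}\hat U$ be the REF-LU factorizations of $A$ and $\hat A$, respectively. Then the result of applying forward substitution on $\mathbf{w}$ using $U^T$ matches the result of applying forward substitution on $\mathbf{w}$ using $\hat U^T$, that is, $$(U^TD^{-1})^{-1}\mathbf{w}=(\hat U^T\hat D^{-1})^{-1}\mathbf{w}.$$
   Context: Let $M\in\mathbb{R}^{n\times n}$ have all leading principal minors nonzero. Integer-preserving Gaussian elimination (IPGE) on $M$ (no permutations): $m^{(0)}_{i,j}=m_{i,j}$, $\rho^{(0)}=1$, and for $k=1,\dots,n$, with pivot $\rho^{(k)}=m^{(k-1)}_{k,k}$, set, for $k\le i,j\le n$, $m^{(k)}_{i,j}=m^{(k-1)}_{i,j}$ if $i=k$, and $m^{(k)}_{i,j}=\bigl(\rho^{(k)}m^{(k-1)}_{i,j}-m^{(k-1)}_{k,j}m^{(k-1)}_{i,k}\bigr)/\rho^{(k-1)}$ otherwise. (The pivot $\rho^{(k)}$ equals the $k$th leading principal minor of $M$, hence is nonzero.) The REF-LU factorization of $M$ is the triple $L,D,U$ where $L$ is lower triangular with $l_{i,j}=m^{(j-1)}_{i,j}$ for $i\ge j$, $D$ is diagonal with $d_{i,i}=\rho^{(i-1)}\rho^{(i)}$, and $U$ is upper triangular with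 $u_{i,j}=m^{(i-1)}_{i,j}$ for $i\le j$; it satisfies $M=LD^{-1}U$ and $l_{i,i}=u_{i,i}=\rho^{(i)}$. The result of (REF) forward substitution on a vector $\mathbf{b}$ using $U^T$ is the vector $\mathbf{z}$ solving $U^TD^{-1}\mathbf{z}=\mathbf{b}$. *)

theory Defs
  imports "Jordan_Normal_Form.Determinant" "Jordan_Normal_Form.Gauss_Jordan_Elimination"
begin

definition leading_minor :: "real mat \<Rightarrow> nat \<Rightarrow> real" where
  "leading_minor M k = det (mat k k (\<lambda>(i, j). M $$ (i, j)))"

text \<open>
  Rows and columns are indexed from 0, iterations and pivots are numbered as usual:
  \<open>ipge M k i j\<close> is $m^{(k)}_{i+1,j+1}$ and \<open>pivot M k\<close> is $\rho^{(k)}$.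
  Hence the pivot row of iteration \<open>Suc k\<close> has index \<open>k\<close>.
  Both functions are total; the values of \<open>ipge M k i j\<close> are meaningful for
  \<open>k \<le> Suc i\<close>, \<open>k \<le> Suc j\<close> and \<open>i\<close>, \<open>j\<close> less than the dimension, and within this
  range the recursion only refers to meaningful values.
\<close>

function ipge :: "real mat \<Rightarrow> nat \<Rightarrow> nat \<Rightarrow> nat \<Rightarrow> real"
  and pivot :: "real mat \<Rightarrow> nat \<Rightarrow> real"
where
  "ipge M 0 i j = M $$ (i, j)"
| "ipge M (Suc k) i j =
     (if i = k then ipge M k i j
      else (pivot M (Suc k) * ipge M k i j - ipge M k k j * ipge M k i k) / pivot M k)"
| "pivot M 0 = 1"
| "pivot M (Suc k) = ipge M k k k"
  by pat_completeness auto
termination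
  by (relation "measure (\<lambda>x. case x of Inl (M, k, i, j) \<Rightarrow> 2 * k | Inr (M, k) \<Rightarrow> 2 * k - 1)") auto

definition ref_lu :: "real mat \<Rightarrow> real mat \<times> real mat \<times> real mat" where
  "ref_lu M = (let n = dim_row M in
     (mat n n (\<lambda>(i, j). if j \<le> i then ipge M j i j else 0),
      mat_diag n (\<lambda>i. pivot M i * pivot M (Suc i)),
      mat n n (\<lambda>(i, j). if i \<le> j then ipge M i i j else 0)))"

text \<open>The matrix inverse; unspecified if the matrix is not invertible.\<close>

definition mat_inv :: "real mat \<Rightarrow> real mat" where
  "mat_inv M = the (mat_inverse M)"

definition forward_subst :: "real mat \<Rightarrow> real mat \<Rightarrow> real vec \<Rightarrow> real vec" where
  "forward_subst D U b =
     (THE z. z \<in> carrier_vec (dim_vec b) \<and> (U\<^sup>T * mat_inv D) *\<^sub>v z = b)"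

end

theory Submission
  imports Defs
begin

text \<open>
  Append \<open>w\<close> to \<open>A\<close> as an extra row and eliminate. Telescoping the recursion for that row
  shows that its entries \<open>z l\<close> in column \<open>l\<close> after \<open>l\<close> iterations solve
  \<open>(U\<^sup>T D\<^sup>-\<^sup>1) z = w\<close>. Moreover \<open>z l\<close> is the determinant
  of the first \<open>l\<close> rows of \<open>A\<close> bordered below by \<open>w\<close>, restricted to the first \<open>Suc l\<close> columns.
  Passing to \<open>A + v w\<^sup>T\<close> adds multiples of the last row of this matrix to the others,
  which does not change its determinant.
\<close>

section \<open>Elimination entries, and pivots as leading minors\<close>

text \<open>By induction, an entry after \<open>k\<close> iterations depends only on the leading
  block of size \<open>k\<close>, the start of its row, its column above row \<open>k\<close>, and
  its own initial value. Hence a row may be moved to another index, provided it is never a pivot row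
  in these iterations.\<close>

lemma ipge_reindex:
  assumes "k \<le> i" "k \<le> i'"
    and "\<And>a b. a < k \<Longrightarrow> b < k \<Longrightarrow> M $$ (a, b) = N $$ (a, b)"
    and "\<And>b. b < k \<Longrightarrow> M $$ (i, b) = N $$ (i', b)"
    and "\<And>a. a < k \<Longrightarrow> M $$ (a, j) = N $$ (a, j')"
    and "M $$ (i, j) = N $$ (i', j')"
  shows "ipge M k i j = ipge N k i' j'"
  using assms
proof (induction k arbitrary: i i' j j' rule: less_induct)
  case (less k)
  show ?case
  proof (cases k)
    case 0
    then show ?thesis using less.prems by simp
  next
    case (Suc m)
    note p = less.prems[unfolded Suc]
    have "ipge M m i j = ipge N m i' j'"
      by (rule less.IH) (use p Suc in auto)
    moreover have "ipge M m m j = ipge N m m j'"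
      by (rule less.IH) (use p Suc in auto)
    moreover have "ipge M m i m = ipge N m i' m"
      by (rule less.IH) (use p Suc in auto)
    moreover have "pivot M (Suc m) = pivot N (Suc m)"
      unfolding pivot.simps by (rule less.IH) (use p Suc in auto)
    moreover have "pivot M m = pivot N m"
    proof (cases m)
      case (Suc m')
      show ?thesis
        unfolding \<open>m = Suc m'\<close> pivot.simps
        by (rule less.IH) (use p Suc \<open>k = Suc m\<close> in auto)
    qed simp
    ultimately show ?thesis
      using p(1,2) by (simp only: Suc ipge.simps) auto
  qed
qed

text \<open>The quantity that telescopes is \<open>ipge M k i j / pivot M k\<close>: since row
  \<open>i\<close> is not yet a pivot row, iteration \<open>Suc k\<close> lowers it by exactly the
  summand \<open>l = k\<close>.\<close>

lemma ipge_telescope: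
  assumes "k \<le> i" and "\<And>l. l \<le> k \<Longrightarrow> pivot M l \<noteq> 0"
  shows "M $$ (i, j) = (\<Sum>l<k. ipge M l i l * ipge M l l j / (pivot M l * pivot M (Suc l)))
           + ipge M k i j / pivot M k"
  using assms
proof (induction k)
  case 0
  then show ?case by simp
next
  case (Suc k)
  have nz: "pivot M k \<noteq> 0" "pivot M (Suc k) \<noteq> 0"
    using Suc.prems(2)[of k] Suc.prems(2)[of "Suc k"] by auto
  have "ipge M (Suc k) i j
      = (pivot M (Suc k) * ipge M k i j - ipge M k k j * ipge M k i k) / pivot M k"
    using Suc.prems(1) by (simp only: ipge.simps) auto
  then have "ipge M k i j / pivot M k =
      ipge M k i k * ipge M k k j / (pivot M k * pivot M (Suc k))
        + ipge M (Suc k) i j / pivot M (Suc k)"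
    using nz by (simp add: field_simps del: pivot.simps(2) ipge.simps(2))
  then show ?case
    using Suc by (simp del: pivot.simps(2) ipge.simps(2))
qed

lemma ipge_below_pivot:
  assumes "j < i"
  shows "ipge M (Suc j) i j = 0"
  using assms by simp

text \<open>Scaling the columns of \<open>L\<close> so that its diagonal becomes \<open>1 / pivot M i\<close> keeps the
  factorization meaningful for a possibly zero last pivot.\<close>

lemma pivot_Suc_eq_leading_minor:
  assumes nz: "\<And>l. l \<le> k \<Longrightarrow> pivot M l \<noteq> 0"
  shows "pivot M (Suc k) = leading_minor M (Suc k)"
proof -
  define n where "n = Suc k"
  define L where "L = mat n n (\<lambda>(i, l). if l < i then ipge M l i l / (pivot M l * pivot M (Suc l))
      else if l = i then 1 / pivot M i else 0)"
  define U where "U = mat n n (\<lambda>(l, j). if l \<le> j then ipge M l l j else 0)"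
  have carr: "L \<in> carrier_mat n n" "U \<in> carrier_mat n n"
    by (auto simp: L_def U_def)
  have "mat n n (\<lambda>(i, j). M $$ (i, j)) = L * U"
  proof (rule eq_matI)
    fix i j assume "i < dim_row (L * U)" "j < dim_col (L * U)"
    then have i: "i < n" and j: "j < n" using carr by auto
    have "(L * U) $$ (i, j) = (\<Sum>l<n. L $$ (i, l) * U $$ (l, j))"
      using i j carr by (simp add: scalar_prod_def atLeast0LessThan)
    also have "\<dots> = M $$ (i, j)"
    \<comment> \<open>On and above the diagonal the telescoping stops after \<open>i\<close>
      iterations, so it never divides by the last pivot, and the remainder is the diagonal term
      \<open>l = i\<close>. Below the diagonal it runs for \<open>Suc j\<close> iterations, which
      leave remainder 0.\<close>
    proof (cases "i \<le> j")
      case True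
      have "(\<Sum>l<n. L $$ (i, l) * U $$ (l, j)) = (\<Sum>l<Suc i. L $$ (i, l) * U $$ (l, j))"
        by (rule sum.mono_neutral_right) (use i in \<open>auto simp: L_def U_def\<close>)
      also have "\<dots> = (\<Sum>l<i. L $$ (i, l) * U $$ (l, j)) + ipge M i i j / pivot M i"
        using i j True by (simp add: L_def U_def)
      also have "(\<Sum>l<i. L $$ (i, l) * U $$ (l, j))
          = (\<Sum>l<i. ipge M l i l * ipge M l l j / (pivot M l * pivot M (Suc l)))"
        by (rule sum.cong) (use i j True in \<open>auto simp: L_def U_def\<close>)
      finally show ?thesis
        using ipge_telescope[of i i M j] nz i by (simp add: n_def del: pivot.simps(2))
    next
      case False
      have "(\<Sum>l<n. L $$ (i, l) * U $$ (l, j)) = (\<Sum>l<Suc j. L $$ (i, l) * U $$ (l, j))"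
        by (rule sum.mono_neutral_right) (use j in \<open>auto simp: U_def\<close>)
      also have "\<dots> = (\<Sum>l<Suc j. ipge M l i l * ipge M l l j / (pivot M l * pivot M (Suc l)))"
        by (rule sum.cong) (use i j False in \<open>auto simp: L_def U_def\<close>)
      finally show ?thesis
        using ipge_telescope[of "Suc j" i M j] nz i False ipge_below_pivot[of j i M]
        by (simp add: n_def del: pivot.simps(2) ipge.simps(2) sum.lessThan_Suc)
    qed
    finally show "mat n n (\<lambda>(i, j). M $$ (i, j)) $$ (i, j) = (L * U) $$ (i, j)"
      using i j by simp
  qed (use carr in auto)
  then have "leading_minor M n = det L * det U"
    using carr by (simp add: leading_minor_def det_mult)
  also have "det L = (\<Prod>i<n. L $$ (i, i))"
    using det_lower_triangular[OF _ carr(1)] carr(1)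
    by (auto simp: L_def prod_list_diag_prod atLeast0LessThan)
  also have "\<dots> = (\<Prod>i<n. 1 / pivot M i)"
    by (rule prod.cong) (auto simp: L_def)
  also have "det U = (\<Prod>i<n. U $$ (i, i))"
    using det_upper_triangular[OF _ carr(2)] carr(2)
    by (auto simp: U_def upper_triangular_def prod_list_diag_prod atLeast0LessThan)
  also have "\<dots> = (\<Prod>i<n. pivot M (Suc i))"
    by (rule prod.cong) (auto simp: U_def)
  also have "(\<Prod>i<n. 1 / pivot M i) * (\<Prod>i<n. pivot M (Suc i))
      = (\<Prod>i<n. pivot M (Suc i) / pivot M i)"
    unfolding prod.distrib[symmetric] by (rule prod.cong) auto
  \<comment> \<open>The last factor is split off because \<open>pivot M n\<close> may be 0, while
    telescoping the product requires nonzero terms.\<close>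
  also have "\<dots> = (\<Prod>i<k. pivot M (Suc i) / pivot M i) * (pivot M n / pivot M k)"
    unfolding n_def by (rule prod.lessThan_Suc)
  also have "(\<Prod>i<k. pivot M (Suc i) / pivot M i) = pivot M k / pivot M 0"
    by (rule prod_lessThan_telescope) (rule nz)
  finally have "leading_minor M n = pivot M k / pivot M 0 * (pivot M n / pivot M k)" .
  also have "\<dots> = pivot M n"
    using nz[of k] by (simp del: pivot.simps(2))
  finally show ?thesis unfolding n_def by (rule sym)
qed

text \<open>Strong induction: once the earlier pivots are nonzero, the next one equals a leading
  minor.\<close>

lemma pivot_nonzero:
  assumes "\<And>k. 1 \<le> k \<Longrightarrow> k \<le> n \<Longrightarrow> leading_minor M k \<noteq> 0" and "l \<le> n"
  shows "pivot M l \<noteq> 0"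
  using assms(2)
proof (induction l rule: less_induct)
  case (less l)
  show ?case
  proof (cases l)
    case (Suc k)
    have "pivot M (Suc k) = leading_minor M (Suc k)"
      by (rule pivot_Suc_eq_leading_minor) (use less Suc in auto)
    then show ?thesis using assms(1)[of l] less.prems Suc by simp
  qed simp
qed

section \<open>Bordered determinants\<close>

definition row_bordered :: "real mat \<Rightarrow> real vec \<Rightarrow> nat \<Rightarrow> real mat" where
  "row_bordered M w l = mat (Suc l) (Suc l) (\<lambda>(i, j). if i < l then M $$ (i, j) else w $ j)"

lemma det_row_bordered_rank_one_update:
  assumes "\<And>i j. i < l \<Longrightarrow> j \<le> l \<Longrightarrow> N $$ (i, j) = M $$ (i, j) + v $ i * w $ j"
  shows "det (row_bordered N w l) = det (row_bordered M w l)"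
proof -
  \<comment> \<open>Left multiplication by \<open>E\<close> adds \<open>v $ i\<close> times the last
    row, which is \<open>w\<close>, to row \<open>i < l\<close>. The test \<open>i = j\<close> comes
    first, so the last row itself is kept.\<close>
  define E where "E = mat (Suc l) (Suc l)
    (\<lambda>(i, j). if i = j then 1 else if j = l then v $ i else 0)"
  have E: "E \<in> carrier_mat (Suc l) (Suc l)" by (simp add: E_def)
  have B: "row_bordered M w l \<in> carrier_mat (Suc l) (Suc l)" by (simp add: row_bordered_def)
  have "row_bordered N w l = E * row_bordered M w l"
  proof (rule eq_matI)
    fix i j assume "i < dim_row (E * row_bordered M w l)" "j < dim_col (E * row_bordered M w l)"
    then have i: "i < Suc l" and j: "j < Suc l" using E B by auto
    have "(E * row_bordered M w l) $$ (i, j)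
        = (\<Sum>c<Suc l. E $$ (i, c) * row_bordered M w l $$ (c, j))"
      using i j E B by (simp add: scalar_prod_def atLeast0LessThan)
    also have "\<dots> = (\<Sum>c<l. E $$ (i, c) * row_bordered M w l $$ (c, j)) + E $$ (i, l) * w $ j"
      using i j by (simp add: row_bordered_def)
    also have "(\<Sum>c<l. E $$ (i, c) * row_bordered M w l $$ (c, j))
        = (\<Sum>c<l. if c = i then M $$ (i, j) else 0)"
      by (rule sum.cong) (use i j in \<open>auto simp: E_def row_bordered_def\<close>)
    finally show "row_bordered N w l $$ (i, j) = (E * row_bordered M w l) $$ (i, j)"
      using i j assms[of i j] by (auto simp: E_def row_bordered_def)
  qed (use E B in \<open>auto simp: row_bordered_def\<close>)
  moreover have "det E = 1"
    using det_upper_triangular[OF _ E] E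
    by (auto simp: E_def upper_triangular_def prod_list_diag_prod)
  ultimately show ?thesis using det_mult[OF E B] by simp
qed

text \<open>This is coordinate \<open>j\<close> of the forward substitution system, with the
  bordered determinants as the solution.\<close>

lemma row_eq_sum_ipge:
  assumes nz: "\<And>l. l \<le> n \<Longrightarrow> pivot M l \<noteq> 0" and j: "j < n"
  shows "w $ j = (\<Sum>l<Suc j. ipge M l l j / (pivot M l * pivot M (Suc l)) * det (row_bordered M w l))"
proof -
  \<comment> \<open>The appended row has index \<open>n\<close>, so it is never a pivot row during
    the first \<open>n\<close> iterations and leaves the elimination of \<open>M\<close>
    unchanged.\<close>
  define B where "B = mat (Suc n) n (\<lambda>(i, j). if i < n then M $$ (i, j) else w $ j)"
  have B_ipge: "ipge B l l c = ipge M l l c" if "l < n" "c < n" for l c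
    by (rule ipge_reindex) (use that in \<open>auto simp: B_def\<close>)
  have B_pivot: "pivot B l = pivot M l" if "l \<le> n" for l
    using that B_ipge by (cases l) auto
  have z: "ipge B l n l = det (row_bordered M w l)" if l: "l < n" for l
  proof -
    let ?R = "row_bordered M w l"
    have R_pivot: "pivot ?R c = pivot M c" if "c \<le> l" for c
    proof (cases c)
      case (Suc m)
      show ?thesis
        unfolding Suc pivot.simps
        by (rule ipge_reindex) (use that Suc in \<open>auto simp: row_bordered_def\<close>)
    qed simp
    \<comment> \<open>Moved up to index \<open>l\<close>, the appended row makes this entry the last
      pivot of \<open>?R\<close>. Only the earlier pivots, shared with \<open>M\<close>, have to be
      nonzero; the determinant may vanish.\<close>
    have "ipge B l n l = ipge ?R l l l"
      by (rule ipge_reindex) (use l in \<open>auto simp: row_bordered_def B_def\<close>)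
    also have "\<dots> = leading_minor ?R (Suc l)"
      using pivot_Suc_eq_leading_minor[of l ?R] nz l R_pivot by simp
    also have "mat (Suc l) (Suc l) (\<lambda>(i, j). ?R $$ (i, j)) = ?R"
      by (rule eq_matI) (auto simp: row_bordered_def)
    then have "leading_minor ?R (Suc l) = det ?R"
      by (simp add: leading_minor_def)
    finally show ?thesis .
  qed
  have "w $ j = B $$ (n, j)" using j by (simp add: B_def)
  also have "\<dots> = (\<Sum>l<Suc j. ipge B l n l * ipge B l l j / (pivot B l * pivot B (Suc l)))"
    using ipge_telescope[of "Suc j" n B j] ipge_below_pivot[of j n B] j nz B_pivot
    by (simp del: pivot.simps(2) ipge.simps(2) sum.lessThan_Suc)
  also have "\<dots> = (\<Sum>l<Suc j. ipge M l l j / (pivot M l * pivot M (Suc l)) * det (row_bordered M w l))"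
    by (rule sum.cong) (use j z B_ipge B_pivot in \<open>auto simp del: pivot.simps(2) ipge.simps(2)\<close>)
  finally show ?thesis .
qed

section \<open>Inverses and forward substitution\<close>

lemma mat_inv_left_right:
  assumes A: "A \<in> carrier_mat n n" and det: "det A \<noteq> 0"
  shows "mat_inv A \<in> carrier_mat n n" "A * mat_inv A = 1\<^sub>m n" "mat_inv A * A = 1\<^sub>m n"
proof -
  obtain B where "mat_inverse A = Some B"
    using mat_inverse(1)[OF A, of "()"] det_non_zero_imp_unit[OF A det, of "()"]
    by (cases "mat_inverse A") auto
  then show "mat_inv A \<in> carrier_mat n n" "A * mat_inv A = 1\<^sub>m n" "mat_inv A * A = 1\<^sub>m n"
    using mat_inverse(2)[OF A] by (auto simp: mat_inv_def)
qed

lemma mat_inv_eqI: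
  assumes A: "A \<in> carrier_mat n n" and B: "B \<in> carrier_mat n n" and AB: "A * B = 1\<^sub>m n"
  shows "mat_inv A = B"
proof -
  have "det A * det B = 1" using det_mult[OF A B] AB by simp
  then have "det A \<noteq> 0" by auto
  note inv = mat_inv_left_right[OF A this]
  have "mat_inv A = mat_inv A * (A * B)" using AB inv by simp
  also have "\<dots> = mat_inv A * A * B" using assoc_mult_mat[OF inv(1) A B] by simp
  finally show ?thesis using inv B by simp
qed

text \<open>Serves both to evaluate the explicit inverse and to get the uniqueness demanded by
  \<open>THE\<close> in \<open>forward_subst\<close>.\<close>

lemma mat_inv_mult_vec_eqI:
  assumes A: "A \<in> carrier_mat n n" and "det A \<noteq> 0" and z: "z \<in> carrier_vec n" and "A *\<^sub>v z = b"
  shows "mat_inv A *\<^sub>v b = z"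
proof -
  note inv = mat_inv_left_right[OF assms(1,2)]
  have "mat_inv A *\<^sub>v (A *\<^sub>v z) = mat_inv A * A *\<^sub>v z"
    using assoc_mult_mat_vec[OF inv(1) A z] by simp
  then show ?thesis using inv z assms(4) by simp
qed

text \<open>The solution is expressed through bordered determinants alone, which reduces the
  comparison of two factorizations to that of these determinants.\<close>

lemma ref_forward_subst:
  assumes M: "M \<in> carrier_mat n n" and w: "w \<in> carrier_vec n"
    and minors: "\<And>k. 1 \<le> k \<Longrightarrow> k \<le> n \<Longrightarrow> leading_minor M k \<noteq> 0"
    and LDU: "ref_lu M = (L, D, U)"
  defines "z \<equiv> vec n (\<lambda>l. det (row_bordered M w l))"
  shows "forward_subst D U w = z" and "mat_inv (U\<^sup>T * mat_inv D) *\<^sub>v w = z"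
proof -
  have nz: "pivot M l \<noteq> 0" if "l \<le> n" for l
    using pivot_nonzero[OF minors that] .
  have D: "D = mat_diag n (\<lambda>i. pivot M i * pivot M (Suc i))"
    and U: "U = mat n n (\<lambda>(i, j). if i \<le> j then ipge M i i j else 0)"
    using LDU M by (auto simp: ref_lu_def Let_def)
  let ?d = "\<lambda>i. 1 / (pivot M i * pivot M (Suc i))"
  have "D * mat_diag n ?d = 1\<^sub>m n"
    unfolding D mat_diag_diag
    by (rule eq_matI) (auto simp: mat_diag_def nz simp del: pivot.simps(2))
  then have inv_D: "mat_inv D = mat_diag n ?d"
    by (intro mat_inv_eqI) (auto simp: D)
  define P where "P = U\<^sup>T * mat_inv D"
  have UT: "U\<^sup>T \<in> carrier_mat n n" by (simp add: U)
  have P: "P = mat n n (\<lambda>(i, l). U\<^sup>T $$ (i, l) * ?d l)"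
    unfolding P_def inv_D by (rule mat_diag_mult_right[OF UT])
  have P': "P \<in> carrier_mat n n" by (simp add: P)
  have P_entry: "P $$ (i, l) = (if l \<le> i then ipge M l l i * ?d l else 0)" if "i < n" "l < n" for i l
    using that by (simp add: P U)
  have "det P = (\<Prod>i<n. P $$ (i, i))"
    using det_lower_triangular[OF _ P'] P' P_entry
    by (auto simp: prod_list_diag_prod atLeast0LessThan)
  \<comment> \<open>Each factor is the reciprocal of \<open>pivot M i\<close>, so the product is
    nonzero.\<close>
  also have "\<dots> = (\<Prod>i<n. pivot M (Suc i) * ?d i)"
    by (rule prod.cong) (auto simp: P_entry)
  also have "\<dots> \<noteq> 0" using nz by (auto simp del: pivot.simps(2))
  finally have detP: "det P \<noteq> 0" .
  have z: "z \<in> carrier_vec n" by (simp add: z_def)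
  have Pz: "P *\<^sub>v z = w"
  proof (rule eq_vecI)
    fix i assume "i < dim_vec w"
    then have i: "i < n" using w by simp
    have "(P *\<^sub>v z) $ i = (\<Sum>l<n. P $$ (i, l) * z $ l)"
      using i P' z by (simp add: scalar_prod_def atLeast0LessThan)
    also have "\<dots> = (\<Sum>l<Suc i. P $$ (i, l) * z $ l)"
      by (rule sum.mono_neutral_right) (use i in \<open>auto simp: P_entry\<close>)
    also have "\<dots> = (\<Sum>l<Suc i. ipge M l l i * ?d l * det (row_bordered M w l))"
      by (rule sum.cong) (use i in \<open>auto simp: P_entry z_def\<close>)
    also have "\<dots> = w $ i"
      using row_eq_sum_ipge[of n M i w, OF nz i]
      by (simp del: pivot.simps(2) ipge.simps(2) sum.lessThan_Suc)
    finally show "(P *\<^sub>v z) $ i = w $ i" .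
  qed (use P' w in auto)
  have "forward_subst D U w = (THE x. x \<in> carrier_vec n \<and> P *\<^sub>v x = w)"
    using w by (simp add: forward_subst_def P_def)
  also have "\<dots> = z"
    using z Pz mat_inv_mult_vec_eqI[OF P' detP] by (intro the_equality) blast+
  finally show "forward_subst D U w = z" .
  show "mat_inv (U\<^sup>T * mat_inv D) *\<^sub>v w = z"
    using mat_inv_mult_vec_eqI[OF P' detP z Pz] by (simp add: P_def)
qed

theorem theorem4:
  fixes n :: nat and A Ah L D U Lh Dh Uh :: "real mat" and v w :: "real vec"
  assumes "A \<in> carrier_mat n n"
    and "v \<in> carrier_vec n"
    and "w \<in> carrier_vec n"
    and "Ah = A + mat_of_cols n [v] * (mat_of_cols n [w])\<^sup>T"
    and "\<And>k. 1 \<le> k \<Longrightarrow> k \<le> n \<Longrightarrow> leading_minor A k \<noteq> 0"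
    and "\<And>k. 1 \<le> k \<Longrightarrow> k \<le> n \<Longrightarrow> leading_minor Ah k \<noteq> 0"
    and "ref_lu A = (L, D, U)"
    and "ref_lu Ah = (Lh, Dh, Uh)"
  shows "forward_subst D U w = forward_subst Dh Uh w \<and>
         mat_inv (U\<^sup>T * mat_inv D) *\<^sub>v w = mat_inv (Uh\<^sup>T * mat_inv Dh) *\<^sub>v w"
proof -
  let ?z = "\<lambda>M. vec n (\<lambda>l. det (row_bordered M w l))"
  have prod: "mat_of_cols n [v] * (mat_of_cols n [w])\<^sup>T \<in> carrier_mat n n"
    by (rule mult_carrier_mat[of _ n 1]) auto
  then have carrier_Ah: "Ah \<in> carrier_mat n n"
    unfolding assms(4) by (rule add_carrier_mat)
  have entry: "Ah $$ (i, j) = A $$ (i, j) + v $ i * w $ j" if "i < n" "j < n" for i j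
    unfolding assms(4) using that assms(1)
    by (simp add: scalar_prod_def mat_of_cols_index)
  \<comment> \<open>By \<open>ref_forward_subst\<close>, each side of both claimed equations is one
    of these two vectors.\<close>
  have "?z A = ?z Ah"
  proof (rule eq_vecI)
    fix l assume "l < dim_vec (?z Ah)"
    then have l: "l < n" by simp
    have "det (row_bordered Ah w l) = det (row_bordered A w l)"
      by (rule det_row_bordered_rank_one_update, rule entry) (use l in simp_all)
    then show "?z A $ l = ?z Ah $ l" using l by simp
  qed simp
  then show ?thesis
    using ref_forward_subst[OF assms(1,3,5,7)] ref_forward_subst[OF carrier_Ah assms(3,6,8)]
    by simp
qed

end
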